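(* Let $H$, $H'$, $\tilde H$, $X$, $y$ be as in the context, let $s\ge 1$ be an integer, let $m\in K[X]$ be a monomial, and suppose that $(J(H')^s:m)=\mathfrak p$ is a prime ideal. Then: (a) $(J(H)^s:m)=\mathfrak p$ if and only if $(J(\tilde H)^s:m)=\mathfrak p$; (b) $(J(H)^s:m\cdot m_0)=\mathfrak p+(y)$ for some monomial $m_0\notin\mathfrak p$ if and only if $(J(\tilde H)^s:m)\neq\mathfrak p$.
   Context: Let $K$ be a field. A hypergraph $H=(V,E)$ is a finite simple hypergraph (clutter): $V$ is a finite set of vertices, regarded as variables of the polynomial ring $K[V]$, and $E$ is a collection of subsets of $V$ (edges), none contained in another. For $U\subseteq V$, $\mathfrak p_U$ is the prime ideal generated by the variables in $U$. The cover ideal of $H$ is $J(H)=\bigcap_{e\in E}\mathfrak p_e\subseteq K[V]$. Setting: $X=\{x_1,\dots,x_n\}$, $V=X\cup\{y\}$ with $y\notin X$, and $H=(V,E)$ is a hypergraph in which $y$ belongs to exactly one edge $e_y=\{x_1,\dots,x_t,y\}$. Put $e=e_y\setminus\{y\}=\{x_1,\dots,x_t\}$. It is assumed that $H$ has a shadow on $X$, namely that $H'=(X,(E\setminus\{e_y\})\cup\{e\})$ is again a simple hypergraph with the same number of edges as $H$. Let $\tilde H=(X,E\setminus\{e_y\})$ be the induced subhypergraph of $H$ on $X$. $J(H')$ and $J(\tilde H)$ are ideals of $K[X]$, $J(H)$ is an ideal of $K[V]$; colon ideals are taken in the respective rings. By abuse of notation, for $F\subseteq X$ the symbol $\mathfrak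 p_F$ denotes both the ideal of $K[X]$ and the ideal of $K[V]$ generated by the variables in $F$ (thus a monomial prime $\mathfrak p$ of $K[X]$ is identified with its extension to $K[V]$). The monomial $m_0$ in (b) is a monomial of $K[V]$. *)

theory Defs
  imports "HOL-Library.Poly_Mapping" "HOL-Algebra.Ideal_Product"
begin

text \<open>
  Polynomials in variables of type \<open>'v\<close> are finitely supported maps from exponent vectors to
  coefficients.
\<close>

type_synonym ('v, 'k) mpoly = "('v \<Rightarrow>\<^sub>0 nat) \<Rightarrow>\<^sub>0 'k"

text \<open>
  The ring $K[V]$ for a set \<open>V\<close> of variables. For $X \subseteq V$ the ring $K[X]$ is literally a
  subring of $K[V]$.
\<close>

definition poly_ring :: "'v set \<Rightarrow> ('v, 'k::field) mpoly ring" where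
  "poly_ring V = \<lparr>
     carrier = {f. \<forall>a \<in> Poly_Mapping.keys f. Poly_Mapping.keys a \<subseteq> V},
     monoid.mult = (*), one = 1, ring.zero = 0, add = (+)\<rparr>"

definition var :: "'v \<Rightarrow> ('v, 'k::field) mpoly" where
  "var v = Poly_Mapping.single (Poly_Mapping.single v 1) 1"

definition monomials :: "'v set \<Rightarrow> ('v, 'k::field) mpoly set" where
  "monomials V = {Poly_Mapping.single a 1 |a. Poly_Mapping.keys a \<subseteq> V}"

lemma poly_ring_cring: "cring (poly_ring V :: ('v, 'k::field) mpoly ring)"
proof (rule cringI)
  let ?R = "poly_ring V :: ('v, 'k) mpoly ring"
  show "abelian_group ?R"
  proof (rule abelian_groupI)
    fix f assume f: "f \<in> carrier ?R"
    then show "\<exists>g \<in> carrier ?R. g \<oplus>\<^bsub>?R\<^esub> f = \<zero>\<^bsub>?R\<^esub>"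
      by (intro bexI[of _ "- f"]) (auto simp: poly_ring_def)
  qed (use Poly_Mapping.keys_add in \<open>force simp: poly_ring_def algebra_simps\<close>)+
  show "Group.comm_monoid ?R"
  proof (rule comm_monoidI)
    fix f g assume fg: "f \<in> carrier ?R" "g \<in> carrier ?R"
    have "Poly_Mapping.keys c \<subseteq> V" if c: "c \<in> Poly_Mapping.keys (f * g)" for c
    proof -
      obtain a b where "c = a + b" "a \<in> Poly_Mapping.keys f" "b \<in> Poly_Mapping.keys g"
        using c keys_mult[of f g] by blast
      then show ?thesis
        using fg Poly_Mapping.keys_add[of a b] by (fastforce simp: poly_ring_def)
    qed
    then show "f \<otimes>\<^bsub>?R\<^esub> g \<in> carrier ?R"
      by (simp add: poly_ring_def)
  qed (auto simp: poly_ring_def algebra_simps)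
qed (auto simp: poly_ring_def algebra_simps)

definition simple_hypergraph :: "'v set \<Rightarrow> 'v set set \<Rightarrow> bool" where
  "simple_hypergraph V E \<longleftrightarrow>
     finite V \<and> (\<forall>e \<in> E. e \<subseteq> V) \<and> (\<forall>e \<in> E. \<forall>f \<in> E. e \<subseteq> f \<longrightarrow> e = f)"

definition var_ideal :: "'v set \<Rightarrow> 'v set \<Rightarrow> ('v, 'k::field) mpoly set" where
  "var_ideal V U = Idl\<^bsub>poly_ring V\<^esub> (var ` U)"

text \<open>
  Intersecting with the carrier only matters for a hypergraph without edges, whose cover ideal is
  the unit ideal of $K[V]$.
\<close>

definition cover_ideal :: "'v set \<Rightarrow> 'v set set \<Rightarrow> ('v, 'k::field) mpoly set" where
  "cover_ideal V E = carrier (poly_ring V) \<inter> (\<Inter>e \<in> E. var_ideal V e)"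

text \<open>
  Powers taken in \<^const>\<open>ideals_set\<close>, whose multiplication is the product of ideals and whose
  unit is the whole ring.
\<close>

definition ideal_power :: "('a, 'b) ring_scheme \<Rightarrow> 'a set \<Rightarrow> nat \<Rightarrow> 'a set" where
  "ideal_power R I s = I [^]\<^bsub>ideals_set R\<^esub> s"

definition colon :: "('a, 'b) ring_scheme \<Rightarrow> 'a set \<Rightarrow> 'a \<Rightarrow> 'a set" where
  "colon R I m = {f \<in> carrier R. f \<otimes>\<^bsub>R\<^esub> m \<in> I}"

definition shadow_edges :: "'v \<Rightarrow> 'v set \<Rightarrow> 'v set set \<Rightarrow> 'v set set" where
  "shadow_edges y e\<^sub>y E = (E - {e\<^sub>y}) \<union> {e\<^sub>y - {y}}"

end

theory Submission
  imports Defs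
begin

text \<open>
  All ideals involved are spanned by monomials, hence given by up-closed sets of exponent vectors.
  Grade $K[V]$ by the exponent of $y$ and write $J(H)^s = \bigoplus_k L_k y^k$. The $L_k$ increase
  with $k$, with $L_0 = J(H')^s$ and $L_k = J(\tilde H)^s$ for $k \ge s$. So (a) says that
  the chain $(L_k : m)$, which starts at $\mathfrak p$, is constant if and only if its last term is
  $\mathfrak p$. If it is not constant, let $k$ be least with $(L_k : m) \ne \mathfrak p$ and pick a
  monomial $u \in (L_k : m)$ outside $\mathfrak p$; then $m_0 = u y^{k-1}$ works in (b), because
  $(\mathfrak p : u) = \mathfrak p$ by primality.
\<close>

section \<open>Monomial ideals\<close>

text \<open>The support condition is kept apart from \<open>M\<close>, so that one set of exponent
  vectors can describe ideals of $K[X]$ and of $K[V]$ at once; vectors of \<open>M\<close> that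
  involve other variables are ignored.\<close>

definition monomial_span :: "'v set \<Rightarrow> ('v \<Rightarrow>\<^sub>0 nat) set \<Rightarrow> ('v, 'k::field) mpoly set" where
  "monomial_span V M = {f. \<forall>a \<in> Poly_Mapping.keys f. Poly_Mapping.keys a \<subseteq> V \<and> a \<in> M}"

definition upset :: "('v \<Rightarrow>\<^sub>0 nat) set \<Rightarrow> bool" where
  "upset M \<longleftrightarrow> (\<forall>a \<in> M. \<forall>b. a + b \<in> M)"

lemma upsetD: "upset M \<Longrightarrow> a \<in> M \<Longrightarrow> a + b \<in> M"
  by (simp add: upset_def)

lemma poly_ring_simps [simp]:
  "monoid.mult (poly_ring V) = (*)" "one (poly_ring V) = 1"
  "ring.zero (poly_ring V) = 0" "add (poly_ring V) = (+)"
  by (simp_all add: poly_ring_def)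

lemma carrier_poly_ring: "carrier (poly_ring V) = monomial_span V UNIV"
  by (simp add: poly_ring_def monomial_span_def)

lemma keys_add_nat:
  "Poly_Mapping.keys (a + b :: 'v \<Rightarrow>\<^sub>0 nat) = Poly_Mapping.keys a \<union> Poly_Mapping.keys b"
  by (auto simp: in_keys_iff lookup_add)

lemma monomial_in_span_iff [simp]:
  "(Poly_Mapping.single a 1 :: ('v, 'k::field) mpoly) \<in> monomial_span V M
     \<longleftrightarrow> Poly_Mapping.keys a \<subseteq> V \<and> a \<in> M"
  by (simp add: monomial_span_def)

text \<open>An ideal of this form is determined by its monomials, so every ideal equality in the
  theorem becomes a statement about exponent vectors.\<close>

lemma monomial_span_eq_iff:
  "(monomial_span V M :: ('v, 'k::field) mpoly set) = monomial_span V N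
     \<longleftrightarrow> (\<forall>a. Poly_Mapping.keys a \<subseteq> V \<longrightarrow> (a \<in> M \<longleftrightarrow> a \<in> N))"
proof
  assume eq: "(monomial_span V M :: ('v, 'k) mpoly set) = monomial_span V N"
  show "\<forall>a. Poly_Mapping.keys a \<subseteq> V \<longrightarrow> (a \<in> M \<longleftrightarrow> a \<in> N)"
    using monomial_in_span_iff[of _ V M, where 'k = 'k]
    unfolding eq monomial_in_span_iff by blast
qed (auto simp: monomial_span_def)

lemma poly_mapping_eq_sum_single:
  "f = (\<Sum>a \<in> Poly_Mapping.keys f. Poly_Mapping.single a (Poly_Mapping.lookup f a))"
  by (rule poly_mapping_eqI) (simp add: lookup_sum lookup_single when_def in_keys_iff)

lemma lookup_times_monomial:
  fixes f :: "('v, 'k::field) mpoly"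
  shows "Poly_Mapping.lookup (f * Poly_Mapping.single b 1) (a + b) = Poly_Mapping.lookup f a"
proof -
  have "f * Poly_Mapping.single b 1 =
      (\<Sum>c \<in> Poly_Mapping.keys f. Poly_Mapping.single (c + b) (Poly_Mapping.lookup f c))"
    by (subst poly_mapping_eq_sum_single[of f]) (simp add: sum_distrib_right mult_single)
  then show ?thesis
    by (simp add: lookup_sum lookup_single when_def in_keys_iff)
qed

text \<open>The translation by \<open>b\<close> is injective, so no terms merge or cancel. This is
  why a colon by a monomial can be computed on exponents alone.\<close>

lemma keys_times_monomial:
  fixes f :: "('v, 'k::field) mpoly"
  shows "Poly_Mapping.keys (f * Poly_Mapping.single b 1) = (\<lambda>a. a + b) ` Poly_Mapping.keys f"
proof
  show "Poly_Mapping.keys (f * Poly_Mapping.single b 1) \<subseteq> (\<lambda>a. a + b) ` Poly_Mapping.keys f"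
    using keys_mult[of f "Poly_Mapping.single b 1"] by auto
qed (auto simp: in_keys_iff lookup_times_monomial)

lemma monomial_span_iff:
  "f \<in> monomial_span V M \<longleftrightarrow> f \<in> carrier (poly_ring V) \<and> Poly_Mapping.keys f \<subseteq> M"
  by (auto simp: monomial_span_def carrier_poly_ring)

lemma monomial_span_add:
  "f \<in> monomial_span V M \<Longrightarrow> g \<in> monomial_span V M \<Longrightarrow> f + g \<in> monomial_span V M"
  using Poly_Mapping.keys_add[of f g] by (auto simp: monomial_span_def)

lemma monomial_span_mult:
  assumes f: "f \<in> monomial_span V M" and g: "g \<in> monomial_span V N"
    and MN: "\<And>a b. a \<in> M \<Longrightarrow> b \<in> N \<Longrightarrow> a + b \<in> L"
  shows "f * g \<in> monomial_span V L"
  unfolding monomial_span_def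
proof (intro CollectI ballI)
  fix c assume "c \<in> Poly_Mapping.keys (f * g)"
  then obtain a b where "c = a + b" "a \<in> Poly_Mapping.keys f" "b \<in> Poly_Mapping.keys g"
    using keys_mult[of f g] by blast
  then show "Poly_Mapping.keys c \<subseteq> V \<and> c \<in> L"
    using f g MN by (auto simp: monomial_span_def keys_add_nat)
qed

lemma monomial_span_ideal:
  fixes V :: "'v set"
  assumes M: "upset M"
  shows "ideal (monomial_span V M :: ('v, 'k::field) mpoly set) (poly_ring V)"
proof -
  interpret R: cring "poly_ring V :: ('v, 'k) mpoly ring"
    by (rule poly_ring_cring)
  let ?I = "monomial_span V M :: ('v, 'k) mpoly set"
  \<comment> \<open>The inverse in the ring record is only determined by its defining property, so
    it is first identified with unary minus.\<close>
  have inv: "\<ominus>\<^bsub>poly_ring V\<^esub> f = - f" if "f \<in> carrier (poly_ring V)" for f :: "('v, 'k) mpoly"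
    using that by (intro R.minus_equality) (auto simp: poly_ring_def)
  show ?thesis
  proof (rule idealI)
    show "subgroup ?I (add_monoid (poly_ring V))"
    proof (rule R.add.subgroupI)
      show "?I \<subseteq> carrier (poly_ring V)"
        by (auto simp: monomial_span_iff)
      show "?I \<noteq> {}"
        by (auto simp: monomial_span_def intro: exI[of _ 0])
      show "\<ominus>\<^bsub>poly_ring V\<^esub> f \<in> ?I" if "f \<in> ?I" for f
        using that by (subst inv) (auto simp: monomial_span_def carrier_poly_ring)
    qed (simp add: monomial_span_add)
  next
    fix f g :: "('v, 'k) mpoly" assume f: "f \<in> ?I" and g: "g \<in> carrier (poly_ring V)"
    show "f \<otimes>\<^bsub>poly_ring V\<^esub> g \<in> ?I"
      using monomial_span_mult[of f V M g UNIV M] f g M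
      by (simp add: carrier_poly_ring upsetD)
    then show "g \<otimes>\<^bsub>poly_ring V\<^esub> f \<in> ?I"
      by (simp add: mult.commute)
  qed (rule R.ring_axioms)
qed

text \<open>A polynomial is the sum of its terms, and each term is a constant times a monomial lying
  in \<open>I\<close>.\<close>

lemma monomial_span_subset_ideal:
  fixes I :: "('v, 'k::field) mpoly set"
  assumes I: "ideal I (poly_ring V)"
    and mon: "\<And>a. Poly_Mapping.keys a \<subseteq> V \<Longrightarrow> a \<in> M \<Longrightarrow> Poly_Mapping.single a 1 \<in> I"
  shows "monomial_span V M \<subseteq> I"
proof
  fix f :: "('v, 'k) mpoly" assume f: "f \<in> monomial_span V M"
  interpret ideal I "poly_ring V" by (rule I)
  have single_mem: "Poly_Mapping.single a c \<in> I" if "a \<in> Poly_Mapping.keys f" for a c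
  proof -
    have "Poly_Mapping.single 0 c \<in> carrier (poly_ring V)"
      by (simp add: poly_ring_def)
    then have "Poly_Mapping.single 0 c * Poly_Mapping.single a 1 \<in> I"
      using I_l_closed[of "Poly_Mapping.single a 1" "Poly_Mapping.single 0 c"] mon f that
      by (auto simp: monomial_span_def)
    then show ?thesis
      by (simp add: mult_single)
  qed
  have "(\<Sum>a \<in> A. Poly_Mapping.single a (Poly_Mapping.lookup f a)) \<in> I"
    if "finite A" "A \<subseteq> Poly_Mapping.keys f" for A
    using that
  proof (induction A rule: finite_induct)
    case empty
    then show ?case using additive_subgroup.zero_closed[OF is_additive_subgroup] by simp
  next
    case (insert a A)
    then show ?case using additive_subgroup.a_closed[OF is_additive_subgroup single_mem[of a]] by simp
  qed
  then show "f \<in> I"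
    by (subst poly_mapping_eq_sum_single) simp
qed

lemma genideal_eq_monomial_span:
  fixes G :: "('v, 'k::field) mpoly set"
  assumes M: "upset M" and G: "G \<subseteq> monomial_span V M"
    and gen: "\<And>a. Poly_Mapping.keys a \<subseteq> V \<Longrightarrow> a \<in> M \<Longrightarrow>
      \<exists>b c. a = b + c \<and> Poly_Mapping.single b 1 \<in> G"
  shows "Idl\<^bsub>poly_ring V\<^esub> G = monomial_span V M"
proof
  interpret R: cring "poly_ring V :: ('v, 'k) mpoly ring"
    by (rule poly_ring_cring)
  show "Idl\<^bsub>poly_ring V\<^esub> G \<subseteq> monomial_span V M"
    by (intro R.genideal_minimal monomial_span_ideal M G)
  have sub: "G \<subseteq> carrier (poly_ring V)"
    using G by (auto simp: monomial_span_iff)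
  interpret I: ideal "Idl\<^bsub>poly_ring V\<^esub> G" "poly_ring V"
    by (rule R.genideal_ideal[OF sub])
  show "monomial_span V M \<subseteq> Idl\<^bsub>poly_ring V\<^esub> G"
  proof (rule monomial_span_subset_ideal[OF I.is_ideal])
    fix a assume a: "Poly_Mapping.keys a \<subseteq> V" "a \<in> M"
    then obtain b c where bc: "a = b + c" "Poly_Mapping.single b 1 \<in> G"
      using gen by blast
    have "Poly_Mapping.single c 1 \<in> carrier (poly_ring V :: ('v, 'k) mpoly ring)"
      using a bc by (simp add: poly_ring_def keys_add_nat)
    then have "Poly_Mapping.single b 1 * Poly_Mapping.single c 1 \<in> Idl\<^bsub>poly_ring V\<^esub> G"
      using I.I_r_closed[OF subsetD[OF R.genideal_self[OF sub] bc(2)]] by simp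
    then show "Poly_Mapping.single a 1 \<in> Idl\<^bsub>poly_ring V\<^esub> G"
      by (simp add: mult_single bc)
  qed
qed

lemma var_ideal_eq:
  fixes V U :: "'v set"
  assumes "U \<subseteq> V"
  shows "(var_ideal V U :: ('v, 'k::field) mpoly set)
    = monomial_span V {a. Poly_Mapping.keys a \<inter> U \<noteq> {}}"
  unfolding var_ideal_def
proof (rule genideal_eq_monomial_span)
  show "upset {a. Poly_Mapping.keys a \<inter> U \<noteq> {}}"
    by (auto simp: upset_def keys_add_nat)
  show "var ` U \<subseteq> monomial_span V {a. Poly_Mapping.keys a \<inter> U \<noteq> {}}"
    using assms by (auto simp: var_def)
  fix a :: "'v \<Rightarrow>\<^sub>0 nat"
  assume "a \<in> {a. Poly_Mapping.keys a \<inter> U \<noteq> {}}"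
  then obtain u where u: "u \<in> U" "Poly_Mapping.lookup a u \<noteq> 0"
    by (auto simp: in_keys_iff)
  \<comment> \<open>The truncated subtraction is exact because the exponent of \<open>u\<close> in
    \<open>a\<close> is positive.\<close>
  then have "a = Poly_Mapping.single u 1 + (a - Poly_Mapping.single u 1)"
    by (intro poly_mapping_eqI) (auto simp: lookup_add lookup_minus lookup_single when_def)
  then show "\<exists>b c. a = b + c \<and> Poly_Mapping.single b 1 \<in> (var ` U :: ('v, 'k) mpoly set)"
    using u(1) unfolding var_def by blast
qed

lemma genideal_var:
  "y \<in> V \<Longrightarrow> (Idl\<^bsub>poly_ring V\<^esub> {var y} :: ('v, 'k::field) mpoly set)
     = monomial_span V {a. Poly_Mapping.lookup a y \<noteq> 0}"
  using var_ideal_eq[of "{y}" V] by (simp add: var_ideal_def in_keys_iff)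

lemma colon_monomial_span:
  assumes "Poly_Mapping.keys b \<subseteq> V"
  shows "colon (poly_ring V) (monomial_span V M) (Poly_Mapping.single b 1)
    = (monomial_span V {a. a + b \<in> M} :: ('v, 'k::field) mpoly set)"
  using assms
  by (auto simp: colon_def carrier_poly_ring monomial_span_def keys_times_monomial keys_add_nat)

lemma monomial_span_set_add:
  fixes V :: "'v set"
  assumes "upset M" "upset N"
  shows "monomial_span V M <+>\<^bsub>poly_ring V\<^esub> monomial_span V N
    = (monomial_span V (M \<union> N) :: ('v, 'k::field) mpoly set)"
proof -
  interpret R: cring "poly_ring V :: ('v, 'k) mpoly ring"
    by (rule poly_ring_cring)
  have "Idl\<^bsub>poly_ring V\<^esub> (monomial_span V M \<union> monomial_span V N)
      = (monomial_span V (M \<union> N) :: ('v, 'k) mpoly set)"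
  proof (rule genideal_eq_monomial_span)
    show "upset (M \<union> N)"
      using assms by (auto simp: upset_def)
    show "monomial_span V M \<union> monomial_span V N
        \<subseteq> (monomial_span V (M \<union> N) :: ('v, 'k) mpoly set)"
      by (auto simp: monomial_span_def)
    show "\<exists>b c. a = b + c \<and>
        (Poly_Mapping.single b 1 :: ('v, 'k) mpoly) \<in> monomial_span V M \<union> monomial_span V N"
      if "Poly_Mapping.keys a \<subseteq> V" "a \<in> M \<union> N" for a
      using that by (intro exI[of _ a] exI[of _ 0]) auto
  qed
  then show ?thesis
    using R.union_genideal[OF monomial_span_ideal[OF assms(1)] monomial_span_ideal[OF assms(2)]]
    by simp
qed

section \<open>Products and powers of monomial ideals\<close>

lemma ideal_prod_monomial_span:
  fixes V :: "'v set"
  assumes "upset M" "upset N"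
  shows "monomial_span V M \<cdot>\<^bsub>poly_ring V\<^esub> monomial_span V N
    = (monomial_span V {a + b |a b. a \<in> M \<and> b \<in> N} :: ('v, 'k::field) mpoly set)"
    (is "?P = ?S")
proof
  interpret R: cring "poly_ring V :: ('v, 'k) mpoly ring"
    by (rule poly_ring_cring)
  show "?P \<subseteq> ?S"
  proof
    fix f assume "f \<in> ?P"
    then show "f \<in> ?S"
    proof (induction rule: ideal_prod.induct)
      case (prod f g)
      show ?case
        by (auto intro: monomial_span_mult[OF prod])
    qed (simp add: monomial_span_add)
  qed
  show "?S \<subseteq> ?P"
  proof (rule monomial_span_subset_ideal)
    show "ideal ?P (poly_ring V)"
      by (intro R.ideal_prod_is_ideal monomial_span_ideal assms)
    fix c assume "Poly_Mapping.keys c \<subseteq> V" "c \<in> {a + b |a b. a \<in> M \<and> b \<in> N}"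
    \<comment> \<open>Natural exponents cannot cancel, so both factors of a monomial of $K[V]$ lie
      in $K[V]$ again.\<close>
    then obtain a b where c: "c = a + b" "a \<in> M" "b \<in> N"
        "Poly_Mapping.keys a \<subseteq> V" "Poly_Mapping.keys b \<subseteq> V"
      by (auto simp: keys_add_nat)
    then have "Poly_Mapping.single a 1 \<otimes>\<^bsub>poly_ring V\<^esub> Poly_Mapping.single b 1 \<in> ?P"
      by (intro ideal_prod.prod) simp_all
    then show "Poly_Mapping.single c 1 \<in> ?P"
      by (simp add: c mult_single)
  qed
qed

text \<open>The base case is \<open>UNIV\<close> because the zeroth power of an ideal is the whole
  ring; starting from {0} would not give an up-closed set.\<close>

primrec sumset_power :: "('v \<Rightarrow>\<^sub>0 nat) set \<Rightarrow> nat \<Rightarrow> ('v \<Rightarrow>\<^sub>0 nat) set" where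
  "sumset_power M 0 = UNIV"
| "sumset_power M (Suc n) = {a + b |a b. a \<in> sumset_power M n \<and> b \<in> M}"

lemma upset_sumset_power:
  assumes "upset M"
  shows "upset (sumset_power M n)"
proof (cases n)
  case (Suc k)
  then show ?thesis
    using assms unfolding upset_def by (auto simp: add.assoc) blast
qed (simp add: upset_def)

lemma ideal_power_monomial_span:
  assumes "upset M"
  shows "ideal_power (poly_ring V) (monomial_span V M) n
    = (monomial_span V (sumset_power M n) :: ('v, 'k::field) mpoly set)"
proof (induction n)
  case 0
  then show ?case
    by (simp add: ideal_power_def ideals_set_def carrier_poly_ring)
next
  case (Suc n)
  have "ideal_power (poly_ring V) (monomial_span V M) (Suc n)
      = ideal_power (poly_ring V) (monomial_span V M) n
          \<cdot>\<^bsub>poly_ring V\<^esub> (monomial_span V M :: ('v, 'k) mpoly set)"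
    by (simp add: ideal_power_def) (simp add: ideals_set_def)
  then show ?case
    by (simp add: Suc ideal_prod_monomial_span upset_sumset_power assms)
qed

section \<open>Exponents of powers of cover ideals\<close>

text \<open>These are the monomials whose support is a vertex cover (transversal) of
  \<open>E\<close>.\<close>

definition cover_exponents :: "'v set set \<Rightarrow> ('v \<Rightarrow>\<^sub>0 nat) set" where
  "cover_exponents E = {a. \<forall>e \<in> E. Poly_Mapping.keys a \<inter> e \<noteq> {}}"

lemma upset_cover_exponents: "upset (cover_exponents E)"
  by (fastforce simp: upset_def cover_exponents_def keys_add_nat)

lemma upset_cover_power: "upset (sumset_power (cover_exponents E) n)"
  by (intro upset_sumset_power upset_cover_exponents)

lemma cover_ideal_eq:
  assumes "E \<subseteq> Pow V"
  shows "(cover_ideal V E :: ('v, 'k::field) mpoly set) = monomial_span V (cover_exponents E)"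
proof -
  have "var_ideal V e = (monomial_span V {a. Poly_Mapping.keys a \<inter> e \<noteq> {}} :: ('v, 'k) mpoly set)"
    if "e \<in> E" for e
    using assms that by (intro var_ideal_eq) blast
  then show ?thesis
    by (auto simp: cover_ideal_def carrier_poly_ring monomial_span_def cover_exponents_def)
qed

lemma colon_cover_power:
  assumes "E \<subseteq> Pow V" "Poly_Mapping.keys b \<subseteq> V"
  shows "colon (poly_ring V) (ideal_power (poly_ring V) (cover_ideal V E) n)
      (Poly_Mapping.single b 1)
    = (monomial_span V {a. a + b \<in> sumset_power (cover_exponents E) n} :: ('v, 'k::field) mpoly set)"
  using assms
  by (simp add: cover_ideal_eq ideal_power_monomial_span upset_cover_exponents colon_monomial_span)

lemma sumset_power_mono: "M \<subseteq> N \<Longrightarrow> sumset_power M n \<subseteq> sumset_power N n"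
  by (induction n) auto

lemma sumset_power_map:
  assumes add: "\<And>a b. h (a + b) = h a + h b" and M: "\<And>a. a \<in> M \<Longrightarrow> h a \<in> N"
  shows "a \<in> sumset_power M n \<Longrightarrow> h a \<in> sumset_power N n"
  by (induction n arbitrary: a) (auto simp: add, use M in blast)

section \<open>Erasing the exponent of y, that is, substituting y = 1 in a monomial\<close>

lemma update_zero_add:
  "Poly_Mapping.update y 0 (a + b :: 'v \<Rightarrow>\<^sub>0 nat)
     = Poly_Mapping.update y 0 a + Poly_Mapping.update y 0 b"
  by (rule poly_mapping_eqI) (simp add: lookup_update lookup_add)

lemma update_zero_ident:
  "Poly_Mapping.lookup a y = 0 \<Longrightarrow> Poly_Mapping.update y 0 a = (a :: 'v \<Rightarrow>\<^sub>0 nat)"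
  by (rule poly_mapping_eqI) (auto simp add: lookup_update)

lemma update_zero_add_single:
  "Poly_Mapping.update y 0 (a + Poly_Mapping.single y k :: 'v \<Rightarrow>\<^sub>0 nat)
     = Poly_Mapping.update y 0 a"
  by (rule poly_mapping_eqI) (simp add: lookup_update lookup_add lookup_single when_def)

lemma update_zero_split:
  "(a :: 'v \<Rightarrow>\<^sub>0 nat)
     = Poly_Mapping.update y 0 a + Poly_Mapping.single y (Poly_Mapping.lookup a y)"
  by (rule poly_mapping_eqI) (simp add: lookup_update lookup_add lookup_single when_def)

context
  fixes y :: 'v and e\<^sub>y :: "'v set" and E :: "'v set set"
  assumes y: "y \<in> e\<^sub>y" and unique: "\<forall>f \<in> E. y \<in> f \<longrightarrow> f = e\<^sub>y" and ey: "e\<^sub>y \<in> E"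
begin

text \<open>A monomial free of y can meet \<open>e\<^sub>y\<close> only outside y, so covering
  \<open>e\<^sub>y\<close> and covering its shadow amount to the same.\<close>

lemma cover_shadow_iff:
  assumes "Poly_Mapping.lookup a y = 0"
  shows "a \<in> cover_exponents (shadow_edges y e\<^sub>y E) \<longleftrightarrow> a \<in> cover_exponents E"
proof -
  have "Poly_Mapping.keys a \<inter> (e\<^sub>y - {y}) = Poly_Mapping.keys a \<inter> e\<^sub>y"
    using assms by (auto simp: in_keys_iff)
  moreover have "E = insert e\<^sub>y (E - {e\<^sub>y})"
    using ey by blast
  ultimately show ?thesis
    unfolding cover_exponents_def shadow_edges_def by auto
qed

text \<open>This is $L_0 = J(H')^n$: all factors of a monomial free of y are free of y, so the
  previous equivalence applies to each of them.\<close>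

lemma cover_power_shadow_iff:
  assumes "Poly_Mapping.lookup a y = 0"
  shows "a \<in> sumset_power (cover_exponents (shadow_edges y e\<^sub>y E)) n
    \<longleftrightarrow> a \<in> sumset_power (cover_exponents E) n"
  using assms
proof (induction n arbitrary: a)
  case (Suc n)
  have "(b \<in> sumset_power (cover_exponents (shadow_edges y e\<^sub>y E)) n
        \<and> c \<in> cover_exponents (shadow_edges y e\<^sub>y E))
      \<longleftrightarrow> (b \<in> sumset_power (cover_exponents E) n \<and> c \<in> cover_exponents E)"
    if "a = b + c" for b c
    using Suc.prems Suc.IH[of b] cover_shadow_iff[of c] that by (simp add: lookup_add)
  then show ?case
    by auto
qed simp

lemma cover_power_subset:
  "sumset_power (cover_exponents E) n \<subseteq> sumset_power (cover_exponents (E - {e\<^sub>y})) n"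
  by (intro sumset_power_mono) (auto simp: cover_exponents_def)

text \<open>No edge other than \<open>e\<^sub>y\<close> contains y, so erasing y from each factor
  leaves its intersections with these edges unchanged.\<close>

lemma cover_power_induced_update:
  assumes "a \<in> sumset_power (cover_exponents (E - {e\<^sub>y})) n"
  shows "Poly_Mapping.update y 0 a \<in> sumset_power (cover_exponents (E - {e\<^sub>y})) n"
proof (rule sumset_power_map[where h = "Poly_Mapping.update y 0", OF update_zero_add _ assms])
  fix b :: "'v \<Rightarrow>\<^sub>0 nat" assume b: "b \<in> cover_exponents (E - {e\<^sub>y})"
  have "Poly_Mapping.keys (Poly_Mapping.update y 0 b) \<inter> f = Poly_Mapping.keys b \<inter> f"
    if "f \<in> E - {e\<^sub>y}" for f
    using unique that by (auto simp: keys_update)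
  then show "Poly_Mapping.update y 0 b \<in> cover_exponents (E - {e\<^sub>y})"
    using b by (simp add: cover_exponents_def)
qed

lemma cover_power_induced_add:
  "a \<in> sumset_power (cover_exponents (E - {e\<^sub>y})) n
    \<Longrightarrow> a + Poly_Mapping.single y n \<in> sumset_power (cover_exponents E) n"
proof (induction n arbitrary: a)
  case (Suc n)
  then obtain b c where bc: "a = b + c" "b \<in> sumset_power (cover_exponents (E - {e\<^sub>y})) n"
      "c \<in> cover_exponents (E - {e\<^sub>y})"
    by auto
  have "c + Poly_Mapping.single y 1 \<in> cover_exponents E"
    unfolding cover_exponents_def
  proof (intro CollectI ballI)
    fix f assume "f \<in> E"
    then show "Poly_Mapping.keys (c + Poly_Mapping.single y 1) \<inter> f \<noteq> {}"
      using bc(3) y by (cases "f = e\<^sub>y") (auto simp: cover_exponents_def keys_add_nat)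
  qed
  moreover have "a + Poly_Mapping.single y (Suc n)
      = (b + Poly_Mapping.single y n) + (c + Poly_Mapping.single y 1)"
    using single_add[of y n 1] by (simp add: bc(1) algebra_simps)
  ultimately show ?case
    using Suc.IH[OF bc(2)] by auto
qed simp

end

section \<open>The colon ideals and the two equivalences\<close>

theorem theorem3p5:
  fixes X :: "'v set" and y :: 'v and e\<^sub>y :: "'v set" and E :: "'v set set"
    and s :: nat and m :: "('v, 'k::field) mpoly" and P :: "('v, 'k) mpoly set"
  assumes "y \<notin> X"
    and "simple_hypergraph (insert y X) E"
    and "e\<^sub>y \<in> E" and "y \<in> e\<^sub>y" and "\<And>f. f \<in> E \<Longrightarrow> y \<in> f \<Longrightarrow> f = e\<^sub>y"
    and "simple_hypergraph X (shadow_edges y e\<^sub>y E)"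
    and "card (shadow_edges y e\<^sub>y E) = card E"
    and "s \<ge> 1"
    and "m \<in> monomials X"
    and "colon (poly_ring X) (ideal_power (poly_ring X) (cover_ideal X (shadow_edges y e\<^sub>y E)) s) m = P"
    and "primeideal P (poly_ring X)"
  shows "(colon (poly_ring (insert y X))
            (ideal_power (poly_ring (insert y X)) (cover_ideal (insert y X) E) s) m
            = Idl\<^bsub>poly_ring (insert y X)\<^esub> P
          \<longleftrightarrow> colon (poly_ring X) (ideal_power (poly_ring X) (cover_ideal X (E - {e\<^sub>y})) s) m = P)
       \<and> ((\<exists>m\<^sub>0 \<in> monomials (insert y X). m\<^sub>0 \<notin> Idl\<^bsub>poly_ring (insert y X)\<^esub> P \<and>
            colon (poly_ring (insert y X))
              (ideal_power (poly_ring (insert y X)) (cover_ideal (insert y X) E) s) (m * m\<^sub>0)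
              = Idl\<^bsub>poly_ring (insert y X)\<^esub> P
                  <+>\<^bsub>poly_ring (insert y X)\<^esub> Idl\<^bsub>poly_ring (insert y X)\<^esub> {var y})
          \<longleftrightarrow> colon (poly_ring X) (ideal_power (poly_ring X) (cover_ideal X (E - {e\<^sub>y})) s) m \<noteq> P)"
proof -
  let ?V = "insert y X"
  obtain b where m: "m = Poly_Mapping.single b 1" and b: "Poly_Mapping.keys b \<subseteq> X"
    using assms(9) by (auto simp: monomials_def)
  have unique: "\<forall>f \<in> E. y \<in> f \<longrightarrow> f = e\<^sub>y"
    using assms(5) by blast
  have EV: "E \<subseteq> Pow ?V"
    using assms(2) by (auto simp: simple_hypergraph_def)
  have EX: "E - {e\<^sub>y} \<subseteq> Pow X"
    using EV unique by blast
  have EX': "shadow_edges y e\<^sub>y E \<subseteq> Pow X"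
    using assms(6) by (auto simp: simple_hypergraph_def)
  have lookup_y: "Poly_Mapping.lookup a y = 0" if "Poly_Mapping.keys a \<subseteq> X" for a :: "'v \<Rightarrow>\<^sub>0 nat"
    using that assms(1) by (auto simp: in_keys_iff)
  have keys_upd: "Poly_Mapping.keys (Poly_Mapping.update y 0 a) \<subseteq> X"
    if "Poly_Mapping.keys a \<subseteq> ?V" for a :: "'v \<Rightarrow>\<^sub>0 nat"
    using that by (auto simp: keys_update)
  define S where "S = {a. a + b \<in> sumset_power (cover_exponents E) s}"
  define T where "T = {a. a + b \<in> sumset_power (cover_exponents (E - {e\<^sub>y})) s}"
  define Q where "Q = {a :: 'v \<Rightarrow>\<^sub>0 nat. Poly_Mapping.update y 0 a \<in> S}"
  have up_S: "upset S"
    using upset_cover_power[of E s] unfolding S_def upset_def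
    by (metis add.commute add.left_commute mem_Collect_eq)
  have up_Q: "upset Q"
    using up_S by (simp add: Q_def upset_def update_zero_add)
  have T_imp_S: "a + Poly_Mapping.single y s \<in> S" if "a \<in> T" for a
    using cover_power_induced_add[OF assms(4) unique assms(3), of "a + b" s] that
    by (simp add: S_def T_def ac_simps)
  have S_imp_T: "a \<in> T" if "a \<in> S" for a
    using cover_power_subset[OF assms(4) unique assms(3)] that by (auto simp: S_def T_def)
  have T_update: "Poly_Mapping.update y 0 a \<in> T" if "a \<in> T" for a
    using cover_power_induced_update[OF assms(4) unique assms(3), of "a + b" s] that
    by (simp add: T_def update_zero_add update_zero_ident[OF lookup_y[OF b]])
  have Q_imp_S: "a \<in> S" if "a \<in> Q" for a
    using upsetD[OF up_S, of "Poly_Mapping.update y 0 a"] that update_zero_split[of a y]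
    by (metis Q_def mem_Collect_eq)
  have P: "P = monomial_span X S"
    unfolding assms(10)[symmetric] m S_def
    by (subst colon_cover_power[OF EX' b], subst monomial_span_eq_iff)
      (simp add: cover_power_shadow_iff[OF assms(4) unique assms(3)] lookup_add lookup_y b)
  have prime: "a \<in> S \<or> c \<in> S"
    if "Poly_Mapping.keys a \<subseteq> X" "Poly_Mapping.keys c \<subseteq> X" "a + c \<in> S" for a c
    using primeideal.I_prime[OF assms(11), of "Poly_Mapping.single a 1" "Poly_Mapping.single c 1"]
      that
    by (simp add: P mult_single carrier_poly_ring keys_add_nat)
  have Idl_P: "Idl\<^bsub>poly_ring ?V\<^esub> P = monomial_span ?V Q"
  proof (rule genideal_eq_monomial_span[OF up_Q])
    show "P \<subseteq> monomial_span ?V Q"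
      by (auto simp: P Q_def monomial_span_def update_zero_ident lookup_y)
    fix a assume a: "Poly_Mapping.keys a \<subseteq> ?V" "a \<in> Q"
    then have "(Poly_Mapping.single (Poly_Mapping.update y 0 a) 1 :: ('v, 'k) mpoly) \<in> P"
      using keys_upd by (simp add: P Q_def)
    then show "\<exists>b c. a = b + c \<and> (Poly_Mapping.single b 1 :: ('v, 'k) mpoly) \<in> P"
      using update_zero_split[of a y] by blast
  qed
  have P_plus_y: "Idl\<^bsub>poly_ring ?V\<^esub> P <+>\<^bsub>poly_ring ?V\<^esub> Idl\<^bsub>poly_ring ?V\<^esub> {var y}
      = monomial_span ?V (Q \<union> {a. Poly_Mapping.lookup a y \<noteq> 0})"
  proof -
    have "upset {a. Poly_Mapping.lookup a y \<noteq> 0}"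
      by (simp add: upset_def lookup_add)
    then show ?thesis
      by (simp only: Idl_P genideal_var[OF insertI1] monomial_span_set_add[OF up_Q])
  qed
  \<comment> \<open>The vector \<open>c\<close> is the exponent of $m_0$; taking \<open>c\<close> =
    0 gives the colon ideal of part (a).\<close>
  have colon_H: "colon (poly_ring ?V) (ideal_power (poly_ring ?V) (cover_ideal ?V E) s)
      (m * Poly_Mapping.single c 1) = monomial_span ?V {a. a + c \<in> S}"
    if "Poly_Mapping.keys c \<subseteq> ?V" for c
    using colon_cover_power[OF EV, of "b + c" s] that b
    by (auto simp: m mult_single S_def keys_add_nat ac_simps)
  \<comment> \<open>Only one inclusion is left to state, as \<open>S\<close> is contained in
    \<open>T\<close>.\<close>
  have colon_induced:
    "colon (poly_ring X) (ideal_power (poly_ring X) (cover_ideal X (E - {e\<^sub>y})) s) m = P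
      \<longleftrightarrow> (\<forall>a. Poly_Mapping.keys a \<subseteq> X \<longrightarrow> a \<in> T \<longrightarrow> a \<in> S)"
    unfolding m colon_cover_power[OF EX b] P monomial_span_eq_iff T_def[symmetric]
    using S_imp_T by blast
  have part_a: "colon (poly_ring ?V) (ideal_power (poly_ring ?V) (cover_ideal ?V E) s) m
        = Idl\<^bsub>poly_ring ?V\<^esub> P
      \<longleftrightarrow> colon (poly_ring X) (ideal_power (poly_ring X) (cover_ideal X (E - {e\<^sub>y})) s) m = P"
    (is "?L = Idl\<^bsub>_\<^esub> P \<longleftrightarrow> ?R = P")
  proof -
    have L: "?L = monomial_span ?V S"
      using colon_H[of 0] by simp
    show ?thesis
      unfolding L Idl_P colon_induced monomial_span_eq_iff
    proof (intro iffI allI impI)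
      fix a assume eq: "\<forall>a. Poly_Mapping.keys a \<subseteq> ?V \<longrightarrow> (a \<in> S \<longleftrightarrow> a \<in> Q)"
        and a: "Poly_Mapping.keys a \<subseteq> X" "a \<in> T"
      \<comment> \<open>The test monomial is \<open>a\<close> times $y^s$: it lies in
        \<open>S\<close> since \<open>a\<close> is in \<open>T\<close>, hence in \<open>Q\<close>,
        and erasing y gives back \<open>a\<close>.\<close>
      have "Poly_Mapping.keys (a + Poly_Mapping.single y s) \<subseteq> ?V"
        using a(1) by (auto simp: keys_add_nat)
      then have "a + Poly_Mapping.single y s \<in> Q"
        using eq T_imp_S[OF a(2)] by blast
      moreover have "Poly_Mapping.update y 0 (a + Poly_Mapping.single y s) = a"
        by (simp add: update_zero_add_single update_zero_ident lookup_y a(1))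
      ultimately show "a \<in> S"
        by (simp add: Q_def)
    next
      fix a :: "'v \<Rightarrow>\<^sub>0 nat"
      assume TS: "\<forall>a. Poly_Mapping.keys a \<subseteq> X \<longrightarrow> a \<in> T \<longrightarrow> a \<in> S"
        and a: "Poly_Mapping.keys a \<subseteq> ?V"
      show "a \<in> Q" if "a \<in> S"
        using TS keys_upd[OF a] T_update[OF S_imp_T[OF that]] unfolding Q_def by blast
      show "a \<in> S" if "a \<in> Q"
        using that by (rule Q_imp_S)
    qed
  qed
  have part_b: "(\<exists>m\<^sub>0 \<in> monomials ?V. m\<^sub>0 \<notin> Idl\<^bsub>poly_ring ?V\<^esub> P \<and>
        colon (poly_ring ?V) (ideal_power (poly_ring ?V) (cover_ideal ?V E) s) (m * m\<^sub>0)
          = Idl\<^bsub>poly_ring ?V\<^esub> P <+>\<^bsub>poly_ring ?V\<^esub> Idl\<^bsub>poly_ring ?V\<^esub> {var y})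
      \<longleftrightarrow> \<not> (\<forall>a. Poly_Mapping.keys a \<subseteq> X \<longrightarrow> a \<in> T \<longrightarrow> a \<in> S)"
    (is "?L \<longleftrightarrow> \<not> ?R")
  proof
    assume ?L
    then obtain c where c: "Poly_Mapping.keys c \<subseteq> ?V" "c \<notin> Q"
      and eq: "monomial_span ?V {a. a + c \<in> S}
        = (monomial_span ?V (Q \<union> {a. Poly_Mapping.lookup a y \<noteq> 0}) :: ('v, 'k) mpoly set)"
      unfolding P_plus_y unfolding Idl_P by (auto simp: monomials_def colon_H)
    have "Poly_Mapping.single y 1 + c \<in> S"
      using eq[unfolded monomial_span_eq_iff, rule_format, of "Poly_Mapping.single y 1"] by simp
    then have "Poly_Mapping.update y 0 (c + Poly_Mapping.single y 1) \<in> T"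
      by (intro T_update S_imp_T) (simp add: add.commute)
    also have "Poly_Mapping.update y 0 (c + Poly_Mapping.single y 1) = Poly_Mapping.update y 0 c"
      by (rule update_zero_add_single)
    finally show "\<not> ?R"
      using c keys_upd by (auto simp: Q_def)
  next
    assume "\<not> ?R"
    then obtain a0 where a0: "Poly_Mapping.keys a0 \<subseteq> X" "a0 \<in> T" "a0 \<notin> S"
      by blast
    define bad where
      "bad k \<longleftrightarrow> (\<exists>u. Poly_Mapping.keys u \<subseteq> X \<and> u \<notin> S \<and> u + Poly_Mapping.single y k \<in> S)" for k
    have "bad s"
      using a0 T_imp_S by (auto simp: bad_def)
    moreover have "\<not> bad 0"
      by (simp add: bad_def)
    \<comment> \<open>The first bad index is written \<open>Suc k\<close>, so the last good exponent
      \<open>k\<close> is the power of y to put into $m_0$.\<close>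
    ultimately obtain k where k: "bad (Suc k)" "\<not> bad k"
      using ex_least_nat_less[of bad s] by blast
    then obtain u where u: "Poly_Mapping.keys u \<subseteq> X" "u \<notin> S"
        "u + Poly_Mapping.single y (Suc k) \<in> S"
      by (auto simp: bad_def)
    define c where "c = u + Poly_Mapping.single y k"
    have keys_c: "Poly_Mapping.keys c \<subseteq> ?V"
      using u(1) by (auto simp: c_def keys_add_nat)
    have "Poly_Mapping.update y 0 c = u"
      by (simp add: c_def update_zero_add_single update_zero_ident lookup_y u(1))
    then have "c \<notin> Q"
      using u(2) by (simp add: Q_def)
    have "a + c \<in> S \<longleftrightarrow> a \<in> Q \<union> {a. Poly_Mapping.lookup a y \<noteq> 0}"
      if a: "Poly_Mapping.keys a \<subseteq> ?V" for a
    proof (cases "Poly_Mapping.lookup a y = 0")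
      case True
      then have upd: "Poly_Mapping.update y 0 a = a"
        by (rule update_zero_ident)
      then have keys_a: "Poly_Mapping.keys a \<subseteq> X"
        using keys_upd[OF a] by simp
      have "a \<in> S" if "a + c \<in> S"
      proof -
        have "(a + u) + Poly_Mapping.single y k \<in> S"
          using that by (simp add: c_def ac_simps)
        then have "a + u \<in> S"
          using k(2) keys_a u(1) keys_add_nat[of a u] unfolding bad_def by (metis Un_least)
        then show ?thesis
          using prime[OF keys_a u(1)] u(2) by blast
      qed
      then show ?thesis
        using True upd upsetD[OF up_S] by (auto simp: Q_def)
    next
      case False
      \<comment> \<open>One y taken from \<open>a\<close> raises $y^k$ to $y^{k+1}$, so
        \<open>a + c\<close> is a multiple of the monomial $u y^{k+1}$ of \<open>S\<close>. The
        subtraction is exact because y divides \<open>a\<close>.\<close>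
      then have "a + c = (u + Poly_Mapping.single y (Suc k)) + (a - Poly_Mapping.single y 1)"
        by (intro poly_mapping_eqI)
          (auto simp: c_def lookup_add lookup_minus lookup_single when_def)
      then show ?thesis
        using False upsetD[OF up_S u(3)] by simp
    qed
    then have "colon (poly_ring ?V) (ideal_power (poly_ring ?V) (cover_ideal ?V E) s)
          (m * Poly_Mapping.single c 1)
        = Idl\<^bsub>poly_ring ?V\<^esub> P <+>\<^bsub>poly_ring ?V\<^esub> Idl\<^bsub>poly_ring ?V\<^esub> {var y}"
      unfolding P_plus_y colon_H[OF keys_c] monomial_span_eq_iff by simp
    moreover have "(Poly_Mapping.single c 1 :: ('v, 'k) mpoly) \<in> monomials ?V"
      using keys_c by (auto simp: monomials_def)
    moreover have "(Poly_Mapping.single c 1 :: ('v, 'k) mpoly) \<notin> Idl\<^bsub>poly_ring ?V\<^esub> P"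
      using \<open>c \<notin> Q\<close> by (simp add: Idl_P)
    ultimately show ?L
      by blast
  qed
  show ?thesis
    using part_a part_b colon_induced by simp
qed

end
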